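(* Let $E$ be a Euclidean space, $F\colon E\to\mathbb R^m$ an analytic map with $m\leqslant\dim E$, $\mathcal M\subseteq E$ its zero set, and $p\in\mathcal M$. If $\gamma(F,p)<\infty$, then $\tau(\mathcal M,p)\,\gamma(F,p)\geqslant\frac1{14}$.
   Context: $\gamma(F,x)=\sup_{k\geq2}\big\|\frac1{k!}\mathrm DF(x)^\dagger\mathrm D^kF(x)\big\|^{1/(k-1)}$ (operator norms, $\dagger$ = Moore–Penrose inverse) if $\mathrm DF(x)$ is surjective, and $\gamma(F,x)=\infty$ otherwise. For nonempty $A\subseteq E$, $d_A(x)=\inf_{a\in A}\|x-a\|$ (and $d_\varnothing=+\infty$); the medial axis of a closed $A$ is the closure of $\Delta_A=\{x\in E:\exists a\neq b\in A,\ \|x-a\|=\|x-b\|=d_A(x)\}$, and the reach of $A$ at $p\in A$ is $\tau(A,p)=d_{\Delta_A}(p)$. *)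

theory Defs
  imports "HOL-Analysis.Analysis" "HOL-Library.Extended_Real"
begin

text \<open>Iterated (Frechet) derivatives, as multilinear maps evaluated on a list of
  directions: hderiv k F x [v1,...,vk] = D^k F(x)(v1,...,vk).\<close>
fun hderiv :: "nat \<Rightarrow> ('a::real_normed_vector \<Rightarrow> 'b::real_normed_vector) \<Rightarrow> 'a \<Rightarrow> 'a list \<Rightarrow> 'b" where
  "hderiv 0 F x vs = F x"
| "hderiv (Suc k) F x vs = frechet_derivative (\<lambda>y. hderiv k F y (tl vs)) (at x) (hd vs)"

definition smooth_map :: "('a::real_normed_vector \<Rightarrow> 'b::real_normed_vector) \<Rightarrow> bool" where
  "smooth_map F \<longleftrightarrow> (\<forall>k vs x. (\<lambda>y. hderiv k F y vs) differentiable (at x))"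

definition real_analytic :: "('a::real_normed_vector \<Rightarrow> 'b::real_normed_vector) \<Rightarrow> bool" where
  "real_analytic F \<longleftrightarrow> smooth_map F \<and>
     (\<forall>x. \<exists>r>0. \<forall>y\<in>ball x r.
        (\<lambda>k. (1 / fact k) *\<^sub>R hderiv k F x (replicate k (y - x))) sums F y)"

text \<open>Moore-Penrose inverse of a linear map L: the minimal-norm least-squares solution,
  i.e. the unique x orthogonal to ker L with y - L x orthogonal to range L.\<close>
definition mp_inverse :: "('a::real_inner \<Rightarrow> 'b::real_inner) \<Rightarrow> 'b \<Rightarrow> 'a" where
  "mp_inverse L y = (THE x. (\<forall>u. inner (y - L x) (L u) = 0) \<and> (\<forall>z. L z = 0 \<longrightarrow> inner x z = 0))"

definition gamma_term :: "('a::euclidean_space \<Rightarrow> 'b::euclidean_space) \<Rightarrow> 'a \<Rightarrow> nat \<Rightarrow> real" where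
  "gamma_term F x k = Sup {norm (mp_inverse (frechet_derivative F (at x)) (hderiv k F x vs))
       | vs. length vs = k \<and> (\<forall>v\<in>set vs. norm v \<le> 1)}"

definition gamma :: "('a::euclidean_space \<Rightarrow> 'b::euclidean_space) \<Rightarrow> 'a \<Rightarrow> ereal" where
  "gamma F x = (if surj (frechet_derivative F (at x))
      then (SUP k\<in>{2..}. ereal (root (k - 1) ((1 / fact k) * gamma_term F x k)))
      else \<infinity>)"

definition medial_pts :: "'a::euclidean_space set \<Rightarrow> 'a set" where
  "medial_pts A = {x. \<exists>a\<in>A. \<exists>b\<in>A. a \<noteq> b \<and> dist x a = infdist x A \<and> dist x b = infdist x A}"

definition medial_axis :: "'a::euclidean_space set \<Rightarrow> 'a set" where
  "medial_axis A = closure (medial_pts A)"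

definition edist_set :: "'a::euclidean_space \<Rightarrow> 'a set \<Rightarrow> ereal" where
  "edist_set x A = (if A = {} then \<infinity> else ereal (infdist x A))"

definition reach :: "'a::euclidean_space set \<Rightarrow> 'a \<Rightarrow> ereal" where
  "reach A p = edist_set p (medial_axis A)"

end

(* Let J be the Moore-Penrose inverse of L = DF(p) and G = J o F; then G has the same zeros as F,
   the values of G lie in range J, on which J L is the identity, and gamma bounds the Taylor
   coefficients of G at p. By uniqueness of analytic continuation along lines the Taylor series
   represents G on the ball of radius 1/(6 gamma), where therefore G - J L is 4/9-Lipschitz and
   G has second differences at most 4 gamma |e|^2. If a point x closer to p than 1/(14 gamma) had
   two nearest zeros m + e and m - e, then |G m| <= 2 gamma |e|^2, so iterating v -> v - G(m + v)
   on range J gives a zero within 18/5 gamma |e|^2 of m. By Pythagoras m is closer to x than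
   m + e by at least |e|^2/(2d), where d < 1/(14 gamma) is the distance from x to the zero set,
   and so the new zero is closer to x than d, a contradiction. *)
theory Submission
  imports Defs "HOL-Complex_Analysis.Complex_Analysis"
begin

section \<open>Multilinear maps: norm bounds, first and second differences on the diagonal\<close>

subsection \<open>Multilinear maps on lists\<close>

text \<open>The recursion peels off the first slot, so that the inductions below can freeze one
  argument at a time; only lists of length \<open>k\<close> are constrained.\<close>

fun multilin :: "nat \<Rightarrow> ('a::real_vector list \<Rightarrow> 'b::real_vector) \<Rightarrow> bool" where
  "multilin 0 f \<longleftrightarrow> True"
| "multilin (Suc k) f \<longleftrightarrow>
     (\<forall>vs. length vs = k \<longrightarrow> linear (\<lambda>v. f (v # vs))) \<and> (\<forall>v. multilin k (\<lambda>vs. f (v # vs)))"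

lemma multilin_compose:
  assumes "linear J" "multilin k f"
  shows "multilin k (\<lambda>vs. J (f vs))"
  using assms(2)
proof (induction k arbitrary: f)
  case (Suc k)
  then show ?case
    using linear_compose[OF _ assms(1)] by (auto simp: o_def)
qed simp

lemma multilin_scaleR: "multilin k f \<Longrightarrow> multilin k (\<lambda>vs. c *\<^sub>R f vs)"
  by (rule multilin_compose) (rule linear_scaleR)

lemma multilin_replicate_scaleR:
  assumes "multilin k f"
  shows "f (replicate k (c *\<^sub>R v)) = c ^ k *\<^sub>R f (replicate k v)"
  using assms
proof (induction k arbitrary: f)
  case (Suc k)
  have lin: "linear (\<lambda>u. f (u # replicate k (c *\<^sub>R v)))" and "multilin k (\<lambda>vs. f (v # vs))"
    using Suc.prems by auto
  then show ?case
    using Suc.IH[of "\<lambda>vs. f (v # vs)"] by (simp add: linear_cmul[OF lin])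
qed simp

text \<open>Expanding the first argument in the finite basis reduces to one slot fewer. The crude
  \<open>C\<close> later shows that the set under \<open>Sup\<close> in \<open>gamma_term\<close> is
  bounded above.\<close>

lemma multilin_bounded:
  fixes f :: "'a::euclidean_space list \<Rightarrow> 'b::real_normed_vector"
  assumes "multilin k f"
  shows "\<exists>C. \<forall>vs. length vs = k \<longrightarrow> norm (f vs) \<le> C * prod_list (map norm vs)"
  using assms
proof (induction k arbitrary: f)
  case 0
  then show ?case by (intro exI[of _ "norm (f [])"]) simp
next
  case (Suc k)
  have "\<exists>C. \<forall>vs. length vs = k \<longrightarrow> norm (f (b # vs)) \<le> C * prod_list (map norm vs)" for b
    using Suc by simp
  then obtain C where C: "\<And>b vs. length vs = k \<Longrightarrow> norm (f (b # vs)) \<le> C b * prod_list (map norm vs)"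
    by metis
  show ?case
  proof (intro exI allI impI)
    fix ws :: "'a list"
    assume "length ws = Suc k"
    then obtain v vs where ws: "ws = v # vs" and len: "length vs = k"
      by (auto simp: length_Suc_conv)
    have lin: "linear (\<lambda>v. f (v # vs))" using Suc.prems len by simp
    have "f (v # vs) = f ((\<Sum>b\<in>Basis. (v \<bullet> b) *\<^sub>R b) # vs)" by (simp add: euclidean_representation)
    also have "\<dots> = (\<Sum>b\<in>Basis. (v \<bullet> b) *\<^sub>R f (b # vs))"
      by (simp add: linear_sum[OF lin] linear_cmul[OF lin])
    also have "norm \<dots> \<le> (\<Sum>b\<in>Basis. norm v * (C b * prod_list (map norm vs)))"
      by (rule sum_norm_le) (auto intro!: mult_mono C len Basis_le_norm)
    finally show "norm (f ws) \<le> (\<Sum>b\<in>Basis. C b) * prod_list (map norm ws)"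
      by (simp add: ws sum_distrib_left sum_distrib_right mult_ac)
  qed
qed

lemma prod_list_norm_le_one:
  "(\<forall>v\<in>set vs. norm v \<le> 1) \<Longrightarrow> prod_list (map norm vs) \<le> 1"
proof (induction vs)
  case (Cons v vs)
  have "prod_list (map norm vs) \<ge> 0" by (rule prod_list_nonneg) auto
  with Cons show ?case by (auto intro!: mult_le_one)
qed simp

text \<open>Homogeneity in each slot carries a bound on the unit ball, which is what
  \<open>gamma_term\<close> supplies, to all vectors.\<close>

lemma multilin_norm_le:
  assumes "multilin k f"
    and "\<And>vs. length vs = k \<Longrightarrow> \<forall>v\<in>set vs. norm v \<le> 1 \<Longrightarrow> norm (f vs) \<le> C"
    and "length vs = k"
  shows "norm (f vs) \<le> C * prod_list (map norm vs)"
  using assms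
proof (induction k arbitrary: f vs)
  case (Suc k)
  obtain v us where vs: "vs = v # us" and len: "length us = k"
    using Suc.prems(3) by (auto simp: length_Suc_conv)
  have lin: "linear (\<lambda>v. f (v # us))" using Suc.prems(1) len by simp
  define w where "w = v /\<^sub>R norm v"
  have "norm w \<le> 1" by (cases "v = 0") (simp_all add: w_def)
  have "v = norm v *\<^sub>R w" by (cases "v = 0") (simp_all add: w_def)
  have "norm (f (w # us)) \<le> C * prod_list (map norm us)"
    using Suc.prems \<open>norm w \<le> 1\<close> by (intro Suc.IH[of "\<lambda>us. f (w # us)"] len) auto
  then have "norm v * norm (f (w # us)) \<le> norm v * (C * prod_list (map norm us))"
    by (rule mult_left_mono) simp
  moreover have "f (v # us) = norm v *\<^sub>R f (w # us)"
    by (subst \<open>v = norm v *\<^sub>R w\<close>) (rule linear_cmul[OF lin])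
  ultimately show ?case by (simp add: vs mult_ac)
qed simp

text \<open>Telescoping: with the head \<open>v\<close> kept, the tails are exchanged by induction
  with constant \<open>C * norm v\<close>; then the head is exchanged by linearity.\<close>

lemma multilin_diff_le:
  assumes "multilin k f" "\<And>vs. length vs = k \<Longrightarrow> norm (f vs) \<le> C * prod_list (map norm vs)"
    and "norm v \<le> r" "norm w \<le> r" "0 \<le> C"
  shows "norm (f (replicate k v) - f (replicate k w)) \<le> C * k * r ^ (k - 1) * norm (v - w)"
  using assms(1,2,5)
proof (induction k arbitrary: f C)
  case (Suc k)
  have r: "r \<ge> 0" using assms(3) norm_ge_zero order_trans by blast
  have lin: "linear (\<lambda>u. f (u # replicate k w))" using Suc.prems(1) by simp
  have "norm (f (v # replicate k v) - f (v # replicate k w))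
      \<le> (C * norm v) * k * r ^ (k - 1) * norm (v - w)"
    using Suc.prems(1,3) Suc.prems(2)[of "v # _"]
    by (intro Suc.IH[of "\<lambda>vs. f (v # vs)"]) (auto simp: mult_ac)
  also have "\<dots> = C * norm v * (k * r ^ (k - 1)) * norm (v - w)" by simp
  also have "\<dots> \<le> C * r * (k * r ^ (k - 1)) * norm (v - w)"
    using Suc.prems(3) r assms(3) by (intro mult_right_mono mult_left_mono) auto
  also have "\<dots> = C * k * r ^ k * norm (v - w)" by (cases k) auto
  finally have 1: "norm (f (v # replicate k v) - f (v # replicate k w)) \<le> C * k * r ^ k * norm (v - w)" .
  have "norm (f ((v - w) # replicate k w)) \<le> C * (norm (v - w) * norm w ^ k)"
    using Suc.prems(2)[of "(v - w) # replicate k w"] by simp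
  also have "\<dots> \<le> C * (norm (v - w) * r ^ k)"
    using Suc.prems(3) assms(4) by (intro mult_left_mono power_mono) auto
  finally have 2: "norm (f (v # replicate k w) - f (w # replicate k w)) \<le> C * norm (v - w) * r ^ k"
    by (simp add: linear_diff[OF lin])
  show ?case
    using norm_triangle_mono[OF 1 2] by (simp add: algebra_simps)
qed simp

text \<open>Splitting the heads \<open>s + e\<close> and \<open>s - e\<close> leaves a second
  difference with head \<open>s\<close>, handled by induction, and a first difference with head
  \<open>e\<close> between points that differ by twice \<open>e\<close>.\<close>

lemma multilin_second_diff_le:
  assumes "multilin k f" "\<And>vs. length vs = k \<Longrightarrow> norm (f vs) \<le> C * prod_list (map norm vs)"
    and "norm s \<le> r" "norm (s + e) \<le> r" "norm (s - e) \<le> r" "0 \<le> C"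
  shows "norm (f (replicate k (s + e)) + f (replicate k (s - e)) - 2 *\<^sub>R f (replicate k s))
    \<le> C * (k * (k - 1)) * r ^ (k - 2) * (norm e)\<^sup>2"
  using assms(1,2,6)
proof (induction k arbitrary: f C)
  case (Suc k)
  have r: "r \<ge> 0" using assms(3) norm_ge_zero order_trans by blast
  let ?P = "replicate k (s + e)" and ?M = "replicate k (s - e)" and ?S = "replicate k s"
  have lin: "linear (\<lambda>u. f (u # ?P))" "linear (\<lambda>u. f (u # ?M))" using Suc.prems(1) by simp_all
  have "norm (f (s # ?P) + f (s # ?M) - 2 *\<^sub>R f (s # ?S))
      \<le> (C * norm s) * (k * (k - 1)) * r ^ (k - 2) * (norm e)\<^sup>2"
    using Suc.prems(1,3) Suc.prems(2)[of "s # _"]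
    by (intro Suc.IH[of "\<lambda>vs. f (s # vs)"]) (auto simp: mult_ac)
  also have "\<dots> = C * norm s * ((k * (k - 1)) * r ^ (k - 2)) * (norm e)\<^sup>2" by simp
  also have "\<dots> \<le> C * r * ((k * (k - 1)) * r ^ (k - 2)) * (norm e)\<^sup>2"
    using Suc.prems(3) r assms(3) by (intro mult_right_mono mult_left_mono) auto
  also have "\<dots> = C * (k * (k - 1)) * r ^ (k - 1) * (norm e)\<^sup>2"
    by (cases k rule: nat.exhaust[case_product nat.exhaust]; cases "k - 1") auto
  finally have 1: "norm (f (s # ?P) + f (s # ?M) - 2 *\<^sub>R f (s # ?S))
      \<le> C * (k * (k - 1)) * r ^ (k - 1) * (norm e)\<^sup>2" .
  have "norm (f (e # ?P) - f (e # ?M)) \<le> (C * norm e) * k * r ^ (k - 1) * norm ((s + e) - (s - e))"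
    using Suc.prems(1,3) Suc.prems(2)[of "e # _"] assms(4,5)
    by (intro multilin_diff_le[of k "\<lambda>vs. f (e # vs)"]) (auto simp: mult_ac)
  also have "\<dots> = C * (2 * k) * r ^ (k - 1) * (norm e)\<^sup>2"
    by (simp add: power2_eq_square flip: scaleR_2)
  finally have 2: "norm (f (e # ?P) - f (e # ?M)) \<le> C * (2 * k) * r ^ (k - 1) * (norm e)\<^sup>2" .
  have "f (replicate (Suc k) (s + e)) + f (replicate (Suc k) (s - e)) - 2 *\<^sub>R f (replicate (Suc k) s)
      = (f (s # ?P) + f (s # ?M) - 2 *\<^sub>R f (s # ?S)) + (f (e # ?P) - f (e # ?M))"
    by (simp add: linear_add[OF lin(1)] linear_diff[OF lin(2)])
  also have "norm \<dots> \<le> C * (k * (k - 1)) * r ^ (k - 1) * (norm e)\<^sup>2 + C * (2 * k) * r ^ (k - 1) * (norm e)\<^sup>2"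
    by (rule norm_triangle_mono[OF 1 2])
  also have "\<dots> = C * (k * (k - 1) + 2 * k) * r ^ (k - 1) * (norm e)\<^sup>2"
    by (simp add: algebra_simps)
  also have "k * (k - 1) + 2 * k = Suc k * (Suc k - 1)" by (cases k) auto
  finally show ?case by (simp add: numeral_2_eq_2)
qed (simp add: scaleR_2)

section \<open>Multilinearity of higher derivatives\<close>

subsection \<open>Iterated derivatives\<close>

text \<open>\<open>H\<close> is an arbitrary family rather than \<open>hderiv\<close> so that the
  induction can fix a head. Linearity passes to the derivative because Frechet derivatives are
  unique.\<close>

lemma multilin_frechet_derivative:
  fixes H :: "'c::real_normed_vector \<Rightarrow> 'a::real_vector list \<Rightarrow> 'b::real_normed_vector"
  assumes "\<And>y. multilin k (H y)" "\<And>vs. length vs = k \<Longrightarrow> (\<lambda>y. H y vs) differentiable (at x)"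
  shows "multilin k (\<lambda>vs. frechet_derivative (\<lambda>y. H y vs) (at x) v)"
  using assms
proof (induction k arbitrary: H)
  case (Suc k)
  show ?case
  proof (simp, intro conjI allI impI)
    fix vs :: "'a list"
    assume len: "length vs = k"
    have lin: "linear (\<lambda>v. H y (v # vs))" for y using Suc.prems(1)[of y] len by simp
    have D: "((\<lambda>y. H y (w # vs)) has_derivative frechet_derivative (\<lambda>y. H y (w # vs)) (at x)) (at x)" for w
      using Suc.prems(2)[of "w # vs"] len by (simp add: frechet_derivative_works)
    show "linear (\<lambda>w. frechet_derivative (\<lambda>y. H y (w # vs)) (at x) v)"
    proof
      fix a b c
      have "((\<lambda>y. H y ((a + b) # vs)) has_derivative (\<lambda>v. frechet_derivative (\<lambda>y. H y (a # vs)) (at x) v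
          + frechet_derivative (\<lambda>y. H y (b # vs)) (at x) v)) (at x)"
        unfolding linear_add[OF lin] by (intro has_derivative_add D)
      from fun_cong[OF frechet_derivative_at[OF this, symmetric], of v] show
        "frechet_derivative (\<lambda>y. H y ((a + b) # vs)) (at x) v
          = frechet_derivative (\<lambda>y. H y (a # vs)) (at x) v + frechet_derivative (\<lambda>y. H y (b # vs)) (at x) v"
        .
      have "((\<lambda>y. H y ((c *\<^sub>R a) # vs)) has_derivative
          (\<lambda>v. c *\<^sub>R frechet_derivative (\<lambda>y. H y (a # vs)) (at x) v)) (at x)"
        unfolding linear_cmul[OF lin] by (intro has_derivative_scaleR_right D)
      from fun_cong[OF frechet_derivative_at[OF this, symmetric], of v] show
        "frechet_derivative (\<lambda>y. H y ((c *\<^sub>R a) # vs)) (at x) v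
          = c *\<^sub>R frechet_derivative (\<lambda>y. H y (a # vs)) (at x) v"
        .
    qed
  next
    fix w
    show "multilin k (\<lambda>vs. frechet_derivative (\<lambda>y. H y (w # vs)) (at x) v)"
      using Suc.prems by (intro Suc.IH) auto
  qed
qed simp

lemma multilin_hderiv:
  assumes "smooth_map F"
  shows "multilin k (hderiv k F x)"
proof (induction k arbitrary: x)
  case (Suc k)
  have d: "(\<lambda>y. hderiv k F y vs) differentiable (at x)" for vs
    using assms by (simp add: smooth_map_def)
  show ?case
    using multilin_frechet_derivative[OF Suc d] linear_frechet_derivative[OF d] by simp
qed simp

section \<open>Minimal-norm right inverses\<close>

subsection \<open>The Moore--Penrose inverse of a surjective map\<close>

text \<open>For surjective \<open>L\<close> the first condition in \<open>mp_inverse\<close> reduces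
  to \<open>L x = y\<close>. Removing from a preimage its kernel component gives a solution; two
  solutions differ by a kernel vector that is orthogonal to itself.\<close>

lemma mp_inverse_props:
  fixes L :: "'a::euclidean_space \<Rightarrow> 'b::real_inner"
  assumes "linear L" "surj L"
  shows "L (mp_inverse L y) = y" and "L z = 0 \<Longrightarrow> inner (mp_inverse L y) z = 0"
    and "L x = y \<Longrightarrow> (\<And>z. L z = 0 \<Longrightarrow> inner x z = 0) \<Longrightarrow> mp_inverse L y = x"
proof -
  let ?P = "\<lambda>y x. (\<forall>u. inner (y - L x) (L u) = 0) \<and> (\<forall>z. L z = 0 \<longrightarrow> inner x z = 0)"
  have P: "?P y x \<longleftrightarrow> L x = y \<and> (\<forall>z. L z = 0 \<longrightarrow> inner x z = 0)" for x y
  proof -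
    have "(\<forall>u. inner (y - L x) (L u) = 0) \<longleftrightarrow> L x = y"
      using assms(2) by (metis eq_iff_diff_eq_0 inner_eq_zero_iff inner_zero_left surjD)
    then show ?thesis by simp
  qed
  have unique: "x = x'" if "?P y x" "?P y x'" for x x' y
  proof -
    have "L (x - x') = 0" using that P linear_diff[OF assms(1)] by simp
    then have "inner (x - x') (x - x') = 0" using that by (simp add: inner_diff_left)
    then show ?thesis by simp
  qed
  have ex: "\<exists>x. ?P y x" for y
  proof -
    obtain z where z: "L z = y" using assms(2) by (metis surjD)
    have sub: "subspace {z. L z = 0}" by (rule linear_subspace_kernel[OF assms(1)])
    obtain a b where ab: "a \<in> span {z. L z = 0}" "\<And>w. w \<in> span {z. L z = 0} \<Longrightarrow> orthogonal b w" "z = a + b"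
      using orthogonal_subspace_decomp_exists by blast
    then have "L b = y" using z linear_add[OF assms(1)] span_eq_iff[THEN iffD2, OF sub] by auto
    with ab(2) sub show ?thesis
      unfolding P by (intro exI[of _ b]) (auto simp: orthogonal_def span_base)
  qed
  have the: "?P y (mp_inverse L y)" for y
  proof -
    obtain x where x: "?P y x" using ex by blast
    show ?thesis
      unfolding mp_inverse_def by (rule theI[of "?P y", OF x]) (rule unique[OF _ x])
  qed
  then show "L (mp_inverse L y) = y" "L z = 0 \<Longrightarrow> inner (mp_inverse L y) z = 0"
    unfolding P by auto
  show "mp_inverse L y = x" if "L x = y" "\<And>z. L z = 0 \<Longrightarrow> inner x z = 0"
    by (rule unique[OF the]) (use that P in blast)
qed

lemma linear_mp_inverse:
  fixes L :: "'a::euclidean_space \<Rightarrow> 'b::real_inner"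
  assumes "linear L" "surj L"
  shows "linear (mp_inverse L)"
  by unfold_locales (auto intro!: mp_inverse_props(3)[OF assms]
      simp: mp_inverse_props[OF assms] linear_add[OF assms(1)] linear_cmul[OF assms(1)] inner_add_left)

section \<open>Identity theorem on an interval, and Taylor expansion along a line\<close>

subsection \<open>Continuation of real power series\<close>

text \<open>Convergence at a real \<open>s\<close> strictly beyond \<open>norm z\<close> forces
  convergence at \<open>z\<close>, so a series converging on a real interval extends holomorphically
  to the disc.\<close>

lemma complex_powser_holomorphic:
  fixes c :: "nat \<Rightarrow> real"
  assumes "\<And>s. \<bar>s\<bar> < r \<Longrightarrow> summable (\<lambda>k. c k * s ^ k)"
  shows "(\<lambda>z. \<Sum>k. complex_of_real (c k) * z ^ k) holomorphic_on ball 0 r"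
proof (rule power_series_holomorphic)
  fix z :: complex
  assume "z \<in> ball 0 r"
  then obtain s where s: "norm z < s" "s < r" using dense[of "norm z" r] by auto
  then have "s > 0" using norm_ge_zero[of z] by linarith
  have "summable (\<lambda>k. complex_of_real (c k * s ^ k))"
    by (intro summable_of_real assms) (use s \<open>s > 0\<close> in auto)
  then have "summable (\<lambda>k. complex_of_real (c k) * z ^ k)"
    using s \<open>s > 0\<close>
    by (intro powser_inside[of "\<lambda>k. complex_of_real (c k)" "complex_of_real s" z]) simp_all
  then show "(\<lambda>k. complex_of_real (c k) * (z - 0) ^ k) sums (\<Sum>k. complex_of_real (c k) * z ^ k)"
    by (simp add: summable_sums)
qed

lemma complex_powser_of_real:
  assumes "(\<lambda>k. c k * s ^ k) sums (y :: real)"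
  shows "(\<Sum>k. complex_of_real (c k) * of_real s ^ k) = of_real y"
  using sums_of_real[OF assms, where 'a = complex] by (simp add: sums_iff)

text \<open>The points around which both functions agree form a clopen set; closedness is the identity
  theorem applied to the complexified local power series.\<close>
lemma real_powser_continuation:
  fixes \<phi> :: "real \<Rightarrow> real" and a :: "nat \<Rightarrow> real"
  assumes analytic: "\<And>t. \<exists>r>0. \<exists>c. \<forall>s. \<bar>s\<bar> < r \<longrightarrow> (\<lambda>k. c k * s ^ k) sums \<phi> (t + s)"
    and near0: "0 < \<epsilon>" "\<And>s. \<bar>s\<bar> < \<epsilon> \<Longrightarrow> (\<lambda>k. a k * s ^ k) sums \<phi> s"
    and summ: "\<And>s. \<bar>s\<bar> < R \<Longrightarrow> summable (\<lambda>k. a k * s ^ k)"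
    and t: "\<bar>t\<bar> < R"
  shows "(\<lambda>k. a k * t ^ k) sums \<phi> t"
proof -
  define I where "I = ball (0::real) R"
  define \<psi> where "\<psi> s = (\<Sum>k. a k * s ^ k)" for s
  \<comment> \<open>Agreement on a neighbourhood, not merely at the point, makes \<open>E\<close>
    open at once.\<close>
  define E where "E = {t \<in> I. \<forall>\<^sub>F s in nhds t. \<phi> s = \<psi> s}"
  have I: "s \<in> I \<longleftrightarrow> \<bar>s\<bar> < R" for s by (simp add: I_def)
  have "open I" "connected I" by (auto simp: I_def)
  have "R > 0" using t by linarith
  have sums\<psi>: "(\<lambda>k. a k * s ^ k) sums \<psi> s" if "s \<in> I" for s
    using summ that unfolding \<psi>_def I by (simp add: summable_sums)
  define \<Psi> where "\<Psi> z = (\<Sum>k. complex_of_real (a k) * z ^ k)" for z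
  have hol\<Psi>: "\<Psi> holomorphic_on ball 0 R"
    unfolding \<Psi>_def by (rule complex_powser_holomorphic) (rule summ)
  have \<Psi>: "\<Psi> (of_real s) = of_real (\<psi> s)" if "s \<in> I" for s
    unfolding \<Psi>_def by (rule complex_powser_of_real) (rule sums\<psi>[OF that])
  have "open E"
    unfolding open_subopen[of E]
  proof
    fix x assume "x \<in> E"
    then obtain S where S: "open S" "x \<in> S" "\<And>s. s \<in> S \<Longrightarrow> \<phi> s = \<psi> s" "x \<in> I"
      unfolding E_def eventually_nhds by auto
    show "\<exists>T. open T \<and> x \<in> T \<and> T \<subseteq> E"
      using S \<open>open I\<close> by (intro exI[of _ "S \<inter> I"]) (auto simp: E_def eventually_nhds)
  qed
  have closed: "x \<in> E" if lim: "x islimpt E" and x: "x \<in> I" for x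
  proof -
    obtain r0 c where r0: "r0 > 0" and c: "\<And>s. \<bar>s\<bar> < r0 \<Longrightarrow> (\<lambda>k. c k * s ^ k) sums \<phi> (x + s)"
      using analytic[of x] by blast
    obtain r1 where r1: "r1 > 0" "ball x r1 \<subseteq> I"
      using \<open>open I\<close> x open_contains_ball by blast
    \<comment> \<open>The bound \<open>R - \<bar>x\<bar>\<close> keeps the complex disc of radius
      \<open>r\<close> around \<open>x\<close> inside the disc on which \<Psi> is
      holomorphic.\<close>
    define r where "r = min (min r0 r1) (R - \<bar>x\<bar>)"
    have r: "r > 0" using r0 r1 x by (auto simp: r_def I)
    have inI: "x + s \<in> I" if "\<bar>s\<bar> < r" for s using that by (auto simp: r_def I)
    define \<Phi> where "\<Phi> z = (\<Sum>k. complex_of_real (c k) * z ^ k)" for z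
    have hol\<Phi>: "\<Phi> holomorphic_on ball 0 r"
      unfolding \<Phi>_def by (rule complex_powser_holomorphic) (use c in \<open>force simp: r_def sums_iff\<close>)
    have \<Phi>: "\<Phi> (of_real s) = of_real (\<phi> (x + s))" if "\<bar>s\<bar> < r" for s
      unfolding \<Phi>_def by (rule complex_powser_of_real) (use c that in \<open>simp add: r_def\<close>)
    have "(\<lambda>z. \<Psi> (of_real x + z)) holomorphic_on ball 0 r"
    proof -
      have "(\<Psi> \<circ> (\<lambda>z. of_real x + z)) holomorphic_on ball 0 r"
      proof (rule holomorphic_on_compose_gen[OF _ hol\<Psi>])
        show "(+) (complex_of_real x) ` ball 0 r \<subseteq> ball 0 R"
        proof (rule image_subsetI)
          fix z :: complex
          assume "z \<in> ball 0 r"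
          then show "of_real x + z \<in> ball 0 R"
            using norm_triangle_ineq[of "of_real x" z] by (simp add: r_def)
        qed
      qed (intro holomorphic_intros)
      then show ?thesis by (simp add: o_def)
    qed
    then have hol: "(\<lambda>z. \<Phi> z - \<Psi> (of_real x + z)) holomorphic_on ball 0 r"
      using hol\<Phi> by (rule holomorphic_on_diff[rotated])
    \<comment> \<open>Displacements from \<open>x\<close> to points of \<open>E\<close>. They
      accumulate at 0 because \<open>x\<close> is a limit point of \<open>E\<close>, as the identity
      theorem requires.\<close>
    define Z where "Z = {complex_of_real s |s. \<bar>s\<bar> < r \<and> x + s \<in> E}"
    have limZ: "0 islimpt Z"
      unfolding islimpt_approachable
    proof (intro allI impI)
      fix e :: real
      assume "e > 0"
      then obtain y where y: "y \<in> E" "y \<noteq> x" "dist y x < min e r"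
        using lim r unfolding islimpt_approachable by (metis min_less_iff_conj)
      show "\<exists>z\<in>Z. z \<noteq> 0 \<and> dist z 0 < e"
        using y by (intro bexI[of _ "of_real (y - x)"])
          (auto simp: Z_def dist_real_def simp flip: of_real_diff)
    qed
    have zero: "\<Phi> z - \<Psi> (of_real x + z) = 0" if "z \<in> Z" for z
    proof -
      obtain s where s: "z = of_real s" "\<bar>s\<bar> < r" "x + s \<in> E" using \<open>z \<in> Z\<close> by (auto simp: Z_def)
      have "\<phi> (x + s) = \<psi> (x + s)"
        using s(3) eventually_nhds_x_imp_x by (auto simp: E_def)
      then show ?thesis
        using \<Phi>[OF s(2)] \<Psi>[OF inI[OF s(2)]] by (simp add: s(1))
    qed
    have "\<phi> y = \<psi> y" if "y \<in> ball x r" for y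
    proof -
      have s: "\<bar>y - x\<bar> < r" using that by (simp add: dist_real_def abs_minus_commute)
      have "\<Phi> (of_real (y - x)) - \<Psi> (of_real x + of_real (y - x)) = 0"
      proof (rule analytic_continuation[OF hol _ _ _ _ limZ])
        show "Z \<subseteq> ball 0 r" by (auto simp: Z_def)
        show "complex_of_real (y - x) \<in> ball 0 r" by (simp only: mem_ball_0 norm_of_real s)
      qed (use r zero in simp_all)
      then show ?thesis
        using \<Phi>[OF s] \<Psi>[OF inI[OF s]] by (simp flip: of_real_add)
    qed
    then show ?thesis
      unfolding E_def eventually_nhds
      by (intro CollectI conjI x exI[of _ "ball x r"]) (simp_all add: r)
  qed
  have "0 \<in> E"
  proof -
    have "\<phi> s = \<psi> s" if "s \<in> ball 0 \<epsilon>" for s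
      using near0(2)[of s] that by (simp add: \<psi>_def sums_iff)
    then show ?thesis
      unfolding E_def eventually_nhds
      by (intro CollectI conjI exI[of _ "ball 0 \<epsilon>"]) (simp_all add: I near0(1) \<open>R > 0\<close>)
  qed
  have "E \<subseteq> I" by (auto simp: E_def)
  have "openin (top_of_set I) E"
    using \<open>open E\<close> \<open>E \<subseteq> I\<close> by (simp add: open_subset)
  moreover have "closedin (top_of_set I) E"
    using closed \<open>E \<subseteq> I\<close> by (simp add: closedin_limpt)
  ultimately have "E = I"
    using \<open>connected I\<close> \<open>0 \<in> E\<close> unfolding connected_clopen by blast
  then have "t \<in> E" using t by (simp add: I)
  then have "\<phi> t = \<psi> t"
    using eventually_nhds_x_imp_x[of "\<lambda>s. \<phi> s = \<psi> s" t] by (simp add: E_def)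
  then show ?thesis
    using sums\<psi>[of t] t by (simp add: I)
qed

text \<open>Analyticity gives each series only locally. Restricting to the line
  \<open>p + s *\<^sub>R v\<close> and pairing with a fixed \<open>u\<close> gives scalar functions,
  for which the series at \<open>p\<close> continues to all
  \<open>\<bar>s\<bar> < 1 / \<theta>\<close>, and this range contains \<open>s = 1\<close>.\<close>

lemma real_analytic_taylor_sums:
  fixes F :: "'a::euclidean_space \<Rightarrow> 'b::euclidean_space" and J :: "'b \<Rightarrow> 'c::euclidean_space"
  assumes F: "real_analytic F" and J: "bounded_linear J" and "\<theta> < 1"
    and bound: "\<And>k. norm (J (hderiv k F p (replicate k v))) / fact k \<le> K * \<theta> ^ k"
    and "0 < \<theta>"
  shows "(\<lambda>k. (1 / fact k) *\<^sub>R J (hderiv k F p (replicate k v))) sums J (F (p + v))"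
proof -
  interpret J: bounded_linear J by (rule J)
  define T where "T x k = (1 / fact k) *\<^sub>R J (hderiv k F x (replicate k v))" for x k
  have smooth: "smooth_map F" using F by (simp add: real_analytic_def)
  have local: "\<exists>r>0. \<forall>s. \<bar>s\<bar> < r \<longrightarrow> (\<lambda>k. s ^ k *\<^sub>R T x k) sums J (F (x + s *\<^sub>R v))" for x
  proof -
    obtain r where r: "r > 0" "\<And>y. y \<in> ball x r \<Longrightarrow>
        (\<lambda>k. (1 / fact k) *\<^sub>R hderiv k F x (replicate k (y - x))) sums F y"
      using F unfolding real_analytic_def by blast
    \<comment> \<open>Adding 1 to the norm avoids division by zero when
      \<open>v = 0\<close>.\<close>
    have "(\<lambda>k. s ^ k *\<^sub>R T x k) sums J (F (x + s *\<^sub>R v))" if "\<bar>s\<bar> < r / (norm v + 1)" for s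
    proof -
      have "norm (s *\<^sub>R v) \<le> \<bar>s\<bar> * (norm v + 1)" by (simp add: mult_left_mono)
      also have "\<dots> < r" using that by (simp add: pos_less_divide_eq add_nonneg_pos)
      finally have "x + s *\<^sub>R v \<in> ball x r" by (simp add: dist_norm)
      from J.sums[OF r(2)[OF this]] show ?thesis
        by (simp add: T_def J.scaleR multilin_replicate_scaleR[OF multilin_hderiv[OF smooth]] mult.commute)
    qed
    moreover have "r / (norm v + 1) > 0" using r by (simp add: add_nonneg_pos)
    ultimately show ?thesis by blast
  qed
  have normT: "norm (T p k) \<le> K * \<theta> ^ k" for k using bound[of k] by (simp add: T_def)
  have summ: "summable (\<lambda>k. s ^ k *\<^sub>R T p k)" if "\<bar>s\<bar> < 1 / \<theta>" for s
  proof (rule summable_comparison_test')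
    show "summable (\<lambda>k. K * (\<theta> * \<bar>s\<bar>) ^ k)"
      using that \<open>0 < \<theta>\<close> by (intro summable_mult summable_geometric) (simp add: field_simps)
    show "norm (s ^ k *\<^sub>R T p k) \<le> K * (\<theta> * \<bar>s\<bar>) ^ k" for k
      using mult_left_mono[OF normT[of k], of "\<bar>s\<bar> ^ k"] by (simp add: power_abs power_mult_distrib mult_ac)
  qed
  obtain r0 where r0: "r0 > 0" "\<And>s. \<bar>s\<bar> < r0 \<Longrightarrow> (\<lambda>k. s ^ k *\<^sub>R T p k) sums J (F (p + s *\<^sub>R v))"
    using local[of p] by blast
  have inner_sums: "(\<lambda>k. (T p k \<bullet> u) * 1 ^ k) sums (J (F (p + 1 *\<^sub>R v)) \<bullet> u)" for u
  proof (rule real_powser_continuation[where R = "1 / \<theta>" and \<phi> = "\<lambda>s. J (F (p + s *\<^sub>R v)) \<bullet> u"])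
    fix t
    obtain r where r: "r > 0" "\<And>s. \<bar>s\<bar> < r \<Longrightarrow>
        (\<lambda>k. s ^ k *\<^sub>R T (p + t *\<^sub>R v) k) sums J (F (p + t *\<^sub>R v + s *\<^sub>R v))"
      using local[of "p + t *\<^sub>R v"] by blast
    show "\<exists>r>0. \<exists>c. \<forall>s. \<bar>s\<bar> < r \<longrightarrow> (\<lambda>k. c k * s ^ k) sums (J (F (p + (t + s) *\<^sub>R v)) \<bullet> u)"
      using r(1) bounded_linear.sums[OF bounded_linear_inner_left r(2), of _ u]
      by (intro exI[of _ r] conjI exI[of _ "\<lambda>k. T (p + t *\<^sub>R v) k \<bullet> u"])
        (auto simp: scaleR_add_left add.assoc mult.commute)
  next
    show "0 < r0" by (rule r0)
  next
    fix s
    assume "\<bar>s\<bar> < r0"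
    from bounded_linear.sums[OF bounded_linear_inner_left r0(2)[OF this], of u]
    show "(\<lambda>k. (T p k \<bullet> u) * s ^ k) sums (J (F (p + s *\<^sub>R v)) \<bullet> u)" by (simp add: mult.commute)
  next
    fix s assume "\<bar>s\<bar> < 1 / \<theta>"
    from bounded_linear.summable[OF bounded_linear_inner_left summ[OF this], of u]
    show "summable (\<lambda>k. (T p k \<bullet> u) * s ^ k)" by (simp add: mult.commute)
  next
    show "\<bar>1\<bar> < 1 / \<theta>" using assms by simp
  qed
  have "T p sums (\<Sum>k. T p k)"
    using summ[of 1] assms by (simp add: summable_sums)
  moreover have "(\<Sum>k. T p k) = J (F (p + v))"
  proof (rule inner_commute[THEN trans, THEN euclidean_eqI])
    fix u :: 'c
    from bounded_linear.sums[OF bounded_linear_inner_left \<open>T p sums (\<Sum>k. T p k)\<close>, of u]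
    show "u \<bullet> (\<Sum>k. T p k) = J (F (p + v)) \<bullet> u"
      using inner_sums[of u] by (auto simp: sums_iff inner_commute)
  qed
  moreover have "T p = (\<lambda>k. (1 / fact k) *\<^sub>R J (hderiv k F p (replicate k v)))"
    by (auto simp: T_def)
  ultimately show ?thesis by simp
qed

section \<open>Geometric majorants, difference estimates and a fixed point argument\<close>

subsection \<open>Estimates for the Taylor series\<close>

text \<open>Consecutive left-hand sides have ratio \<open>(n + 3) / (6 * (n + 2))\<close>, at most
  1/4. Summing the right-hand side gives the Lipschitz constant 4/9.\<close>

lemma power_dominated: "real (n + 2) * (1 / 6) ^ (n + 1) \<le> 1 / 3 * (1 / 4) ^ n"
proof (induction n)
  case (Suc n)
  have "real (Suc n + 2) * (1 / 6) ^ (Suc n + 1) \<le> 1 / 4 * (real (n + 2) * (1 / 6) ^ (n + 1))"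
    by (simp add: field_simps)
  also have "\<dots> \<le> 1 / 4 * (1 / 3 * (1 / 4) ^ n)" by (rule mult_left_mono[OF Suc]) simp
  finally show ?case by simp
qed simp

text \<open>Here the ratio is \<open>(n + 3) / (6 * (n + 1))\<close>, at most 1/2, and the
  right-hand side sums to the constant 4 of \<open>second_diff_le\<close>.\<close>

lemma power_dominated2: "real ((n + 2) * (n + 1)) * (1 / 6) ^ n \<le> 2 * (1 / 2) ^ n"
proof (induction n)
  case (Suc n)
  have "real ((Suc n + 2) * (Suc n + 1)) * (1 / 6) ^ Suc n = real ((n + 2) * (n + 3)) / 6 * (1 / 6) ^ n"
    by (simp add: algebra_simps)
  also have "\<dots> \<le> 1 / 2 * real ((n + 2) * (n + 1)) * (1 / 6) ^ n"
    by (intro mult_right_mono) (simp_all add: field_simps)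
  also have "\<dots> = 1 / 2 * (real ((n + 2) * (n + 1)) * (1 / 6) ^ n)" by (rule mult.assoc)
  also have "\<dots> \<le> 1 / 2 * (2 * (1 / 2) ^ n)" by (rule mult_left_mono[OF Suc]) simp
  finally show ?case by simp
qed simp

lemma sums_tail_norm_le:
  fixes f :: "nat \<Rightarrow> 'a::banach"
  assumes "f sums S" "\<And>n. norm (f (n + 2)) \<le> C * q ^ n" "0 \<le> q" "q < 1"
  shows "norm (S - f 0 - f 1) \<le> C / (1 - q)"
proof -
  have "(\<lambda>n. f (n + 2)) sums (S - (\<Sum>i<2. f i))"
    using assms(1) by (subst sums_iff_shift) simp
  then have tail: "(\<Sum>n. f (n + 2)) = S - f 0 - f 1"
    by (simp add: sums_iff numeral_2_eq_2)
  have geo: "(\<lambda>n. C * q ^ n) sums (C * (1 / (1 - q)))"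
    using assms(3,4) by (intro sums_mult geometric_sums) simp
  have "norm (\<Sum>n. f (n + 2)) \<le> (\<Sum>n. C * q ^ n)"
    using geo assms(2) by (intro norm_suminf_le) (simp_all add: sums_iff)
  then show ?thesis using geo tail by (simp add: sums_iff)
qed

text \<open>\<open>A k\<close> stands for the Taylor coefficient of order \<open>k\<close> at
  \<open>p\<close>, factor \<open>1 / fact k\<close> included. As in \<open>gamma\<close>, norms are
  bounded only from order 2 on.\<close>

locale bounded_taylor =
  fixes G :: "'a::euclidean_space \<Rightarrow> 'b::banach" and A :: "nat \<Rightarrow> 'a list \<Rightarrow> 'b" and p :: 'a and g :: real
  assumes g_pos: "g > 0"
    and multilin: "multilin k (A k)"
    and A_le: "k \<ge> 2 \<Longrightarrow> length vs = k \<Longrightarrow> norm (A k vs) \<le> g ^ (k - 1) * prod_list (map norm vs)"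
    and sums: "norm v \<le> 1 / (6 * g) \<Longrightarrow> (\<lambda>k. A k (replicate k v)) sums G (p + v)"
begin

lemma linear_A1: "linear (\<lambda>v. A (Suc 0) [v])"
  using multilin[of 1] by simp

text \<open>Order 0 cancels and order 1 is \<open>A 1 [v - w]\<close>; what remains is the tail from
  order 2, estimated by \<open>power_dominated\<close>.\<close>

lemma diff_le:
  assumes v: "norm v \<le> 1 / (6 * g)" and w: "norm w \<le> 1 / (6 * g)"
  shows "norm (G (p + v) - G (p + w) - A 1 [v - w]) \<le> 4 / 9 * norm (v - w)"
proof -
  let ?f = "\<lambda>k. A k (replicate k v) - A k (replicate k w)"
  have "norm (G (p + v) - G (p + w) - ?f 0 - ?f 1) \<le> (1 / 3 * norm (v - w)) / (1 - 1 / 4)"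
  proof (rule sums_tail_norm_le)
    show "?f sums (G (p + v) - G (p + w))" by (intro sums_diff sums v w)
    fix n
    have "norm (?f (n + 2)) \<le> g ^ (n + 1) * (n + 2) * (1 / (6 * g)) ^ (n + 1) * norm (v - w)"
      using multilin_diff_le[OF multilin A_le[of "n + 2"] v w] g_pos by simp
    also have "\<dots> = real (n + 2) * (1 / 6) ^ (n + 1) * norm (v - w)"
      using g_pos by (simp add: power_divide power_mult_distrib)
    also have "\<dots> \<le> 1 / 3 * (1 / 4) ^ n * norm (v - w)"
      by (rule mult_right_mono[OF power_dominated]) simp
    finally show "norm (?f (n + 2)) \<le> 1 / 3 * norm (v - w) * (1 / 4) ^ n" by (simp add: mult_ac)
  qed simp_all
  moreover have "?f 1 = A 1 [v - w]"
    by (simp add: linear_diff[OF linear_A1])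
  ultimately show ?thesis by simp
qed

text \<open>Orders 0 and 1 vanish in a second difference. One factor \<open>g\<close> survives
  because the radius cancels only \<open>k - 2\<close> of the \<open>k - 1\<close> powers of
  \<open>g\<close>.\<close>

lemma second_diff_le:
  assumes s: "norm s \<le> 1 / (6 * g)" "norm (s + e) \<le> 1 / (6 * g)" "norm (s - e) \<le> 1 / (6 * g)"
  shows "norm (G (p + (s + e)) + G (p + (s - e)) - 2 *\<^sub>R G (p + s)) \<le> 4 * g * (norm e)\<^sup>2"
proof -
  let ?f = "\<lambda>k. A k (replicate k (s + e)) + A k (replicate k (s - e)) - 2 *\<^sub>R A k (replicate k s)"
  have "norm (G (p + (s + e)) + G (p + (s - e)) - 2 *\<^sub>R G (p + s) - ?f 0 - ?f 1)
      \<le> (2 * g * (norm e)\<^sup>2) / (1 - 1 / 2)"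
  proof (rule sums_tail_norm_le)
    show "?f sums (G (p + (s + e)) + G (p + (s - e)) - 2 *\<^sub>R G (p + s))"
      by (intro sums_diff sums_add sums_scaleR_right sums s)
    fix n
    have "norm (?f (n + 2)) \<le> g ^ (n + 1) * ((n + 2) * (n + 1)) * (1 / (6 * g)) ^ n * (norm e)\<^sup>2"
      using multilin_second_diff_le[OF multilin A_le[of "n + 2"] s] g_pos
      by (simp del: of_nat_mult of_nat_Suc of_nat_add)
    also have "\<dots> = real ((n + 2) * (n + 1)) * (1 / 6) ^ n * (g * (norm e)\<^sup>2)"
      using g_pos by (simp add: power_divide power_mult_distrib)
    also have "\<dots> \<le> 2 * (1 / 2) ^ n * (g * (norm e)\<^sup>2)"
      using g_pos by (intro mult_right_mono power_dominated2 mult_nonneg_nonneg) simp_all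
    finally show "norm (?f (n + 2)) \<le> 2 * g * (norm e)\<^sup>2 * (1 / 2) ^ n" by (simp add: mult_ac)
  qed simp_all
  moreover have "?f 0 = 0" by (simp add: scaleR_2)
  moreover have "?f 1 = 0"
    by (simp add: linear_add[OF linear_A1] linear_diff[OF linear_A1] scaleR_2)
  ultimately show ?thesis by simp
qed

end

text \<open>Banach's fixed point theorem for a simplified Newton iteration. On \<open>S\<close> the
  linear part \<open>P\<close> is the identity, so \<open>v - G (m + v)\<close> contracts by
  \<open>q\<close>; it stays in \<open>S\<close> because \<open>G\<close> takes values
  there.\<close>

lemma exists_zero_near:
  fixes G :: "'a::euclidean_space \<Rightarrow> 'a"
  assumes S: "subspace S" "\<And>y. G y \<in> S"
    and P: "\<And>v. v \<in> S \<Longrightarrow> P v = v"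
    and lip: "\<And>v w. norm v \<le> R \<Longrightarrow> norm w \<le> R \<Longrightarrow>
      norm (G (p + v) - G (p + w) - P (v - w)) \<le> q * norm (v - w)"
    and q: "0 \<le> q" "q < 1"
    and m: "norm (m - p) + \<rho> \<le> R" "norm (G m) \<le> (1 - q) * \<rho>" "0 \<le> \<rho>"
  shows "\<exists>c. norm (c - m) \<le> \<rho> \<and> G c = 0"
proof -
  let ?X = "S \<inter> cball 0 \<rho>" and ?N = "\<lambda>v. v - G (m + v)"
  have contr: "dist (?N v) (?N w) \<le> q * dist v w" if "v \<in> ?X" "w \<in> ?X" for v w
  proof -
    have R: "norm (m - p + u) \<le> R" if "norm u \<le> \<rho>" for u
      using norm_triangle_ineq[of "m - p" u] m(1) that by linarith
    have "norm (G (p + (m - p + v)) - G (p + (m - p + w)) - P ((m - p + v) - (m - p + w)))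
        \<le> q * norm ((m - p + v) - (m - p + w))"
      using that by (intro lip R) auto
    moreover have "P (v - w) = v - w" using that subspace_diff[OF S(1)] by (intro P) auto
    ultimately have "norm (G (m + v) - G (m + w) - (v - w)) \<le> q * norm (v - w)" by simp
    moreover have "?N v - ?N w = - (G (m + v) - G (m + w) - (v - w))" by simp
    ultimately show ?thesis unfolding dist_norm by (metis norm_minus_cancel)
  qed
  have "\<exists>!v\<in>?X. ?N v = v"
  proof (rule Banach_fix[OF _ _ q])
    show "complete ?X"
      by (intro compact_imp_complete closed_Int_compact closed_subspace S(1) compact_cball)
    show "?X \<noteq> {}" using subspace_0[OF S(1)] m(3) by auto
    show "?N ` ?X \<subseteq> ?X"
    proof (rule image_subsetI)
      fix v assume v: "v \<in> ?X"
      \<comment> \<open>The image of 0 uses up \<open>(1 - q) * \<rho>\<close> and the contraction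
        adds at most \<open>q * \<rho>\<close>.\<close>
      have "norm (?N v) \<le> norm (?N 0) + dist (?N v) (?N 0)"
        unfolding dist_norm by (metis norm_triangle_sub)
      also have "\<dots> \<le> (1 - q) * \<rho> + q * \<rho>"
        using contr[OF v, of 0] v subspace_0[OF S(1)] m(2,3) q(1)
        by (intro add_mono) (auto intro: order_trans mult_left_mono)
      finally have "norm (?N v) \<le> \<rho>" by (simp add: algebra_simps)
      moreover have "?N v \<in> S" using v S by (intro subspace_diff) auto
      ultimately show "?N v \<in> ?X" by simp
    qed
  qed (use contr in blast)
  then obtain v where "v \<in> ?X" "?N v = v" by blast
  then show ?thesis by (intro exI[of _ "m + v"]) auto
qed

section \<open>From \<open>gamma\<close> to Taylor bounds, and the contradiction at a medial
  point\<close>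

subsection \<open>The reach of the zero set\<close>

lemma linear_derivative_smooth:
  assumes "smooth_map F"
  shows "linear (frechet_derivative F (at x))"
  using assms[unfolded smooth_map_def, rule_format, of 0] by (intro linear_frechet_derivative) simp

text \<open>Undoes the supremum, the root and the factorial in \<open>gamma\<close>. Taking
  \<open>g\<close> as a mere upper bound lets it be positive even when \<open>gamma F p\<close> is
  0.\<close>

lemma gamma_term_le:
  assumes smooth: "smooth_map F" and surj: "surj (frechet_derivative F (at p))"
    and gamma: "gamma F p \<le> ereal g" and k: "k \<ge> 2" and len: "length vs = k"
  shows "norm (mp_inverse (frechet_derivative F (at p)) (hderiv k F p vs)) / fact k
    \<le> g ^ (k - 1) * prod_list (map norm vs)"
proof -
  let ?J = "mp_inverse (frechet_derivative F (at p))"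
  have "linear (frechet_derivative F (at p))" by (rule linear_derivative_smooth[OF smooth])
  then have ml: "multilin k (\<lambda>vs. ?J (hderiv k F p vs))"
    by (intro multilin_compose[OF linear_mp_inverse[OF _ surj] multilin_hderiv[OF smooth]])
  obtain C where C: "\<And>vs. length vs = k \<Longrightarrow> norm (?J (hderiv k F p vs)) \<le> C * prod_list (map norm vs)"
    using multilin_bounded[OF ml] by blast
  let ?U = "{norm (?J (hderiv k F p vs)) |vs. length vs = k \<and> (\<forall>v\<in>set vs. norm v \<le> 1)}"
  have "bdd_above ?U"
  proof (rule bdd_aboveI)
    fix x assume "x \<in> ?U"
    then obtain vs where vs: "x = norm (?J (hderiv k F p vs))" "length vs = k" "\<forall>v\<in>set vs. norm v \<le> 1"
      by blast
    have "prod_list (map norm vs) \<ge> 0" by (rule prod_list_nonneg) auto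
    then have "C * prod_list (map norm vs) \<le> \<bar>C\<bar> * 1"
      using prod_list_norm_le_one[OF vs(3)] by (intro mult_mono) auto
    then show "x \<le> \<bar>C\<bar>" using C[OF vs(2)] vs(1) by linarith
  qed
  then have le_term: "norm (?J (hderiv k F p us)) \<le> gamma_term F p k"
    if "length us = k" "\<forall>v\<in>set us. norm v \<le> 1" for us
    unfolding gamma_term_def using that by (intro cSup_upper) auto
  have "ereal (root (k - 1) ((1 / fact k) * gamma_term F p k)) \<le> gamma F p"
    unfolding gamma_def using surj k by (auto intro: SUP_upper)
  then have root: "root (k - 1) ((1 / fact k) * gamma_term F p k) \<le> g"
    using gamma order_trans ereal_less_eq(3) by blast
  \<comment> \<open>Nonnegativity lets the power undo the root below.\<close>
  have "0 \<le> gamma_term F p k"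
    by (rule order_trans[OF norm_ge_zero le_term[of "replicate k 0"]]) simp_all
  then have "(1 / fact k) * gamma_term F p k = root (k - 1) ((1 / fact k) * gamma_term F p k) ^ (k - 1)"
    using k by simp
  also have "\<dots> \<le> g ^ (k - 1)"
    using root \<open>0 \<le> gamma_term F p k\<close> k by (intro power_mono) (simp_all add: real_root_ge_zero)
  finally have term_le: "gamma_term F p k \<le> g ^ (k - 1) * fact k" by (simp add: field_simps)
  have "norm (?J (hderiv k F p vs)) \<le> (g ^ (k - 1) * fact k) * prod_list (map norm vs)"
    by (rule multilin_norm_le[OF ml order_trans[OF le_term term_le] len])
  then show ?thesis by (simp add: field_simps)
qed

lemma bounded_taylor_newton:
  fixes F :: "'a::euclidean_space \<Rightarrow> 'b::euclidean_space"
  defines "J \<equiv> \<lambda>p. mp_inverse (frechet_derivative F (at p))"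
  assumes F: "real_analytic F" and surj: "surj (frechet_derivative F (at p))"
    and gamma: "gamma F p \<le> ereal g" and g: "g > 0"
  shows "bounded_taylor (\<lambda>y. J p (F y)) (\<lambda>k vs. (1 / fact k) *\<^sub>R J p (hderiv k F p vs)) p g"
proof
  have smooth: "smooth_map F" using F by (simp add: real_analytic_def)
  have "linear (frechet_derivative F (at p))" by (rule linear_derivative_smooth[OF smooth])
  then have linJ: "linear (J p)" unfolding J_def by (rule linear_mp_inverse[OF _ surj])
  show "g > 0" by (rule g)
  show "multilin k (\<lambda>vs. (1 / fact k) *\<^sub>R J p (hderiv k F p vs))" for k
    by (rule multilin_scaleR[OF multilin_compose[OF linJ multilin_hderiv[OF smooth]]])
  have le: "norm (J p (hderiv k F p vs)) / fact k \<le> g ^ (k - 1) * prod_list (map norm vs)"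
    if "k \<ge> 2" "length vs = k" for k vs
    unfolding J_def by (rule gamma_term_le[OF smooth surj gamma that])
  then show "norm ((1 / fact k) *\<^sub>R J p (hderiv k F p vs)) \<le> g ^ (k - 1) * prod_list (map norm vs)"
    if "k \<ge> 2" "length vs = k" for k vs
    using that by simp
  fix v :: 'a
  assume v: "norm v \<le> 1 / (6 * g)"
  let ?t = "\<lambda>k. norm (J p (hderiv k F p (replicate k v))) / fact k"
  show "(\<lambda>k. (1 / fact k) *\<^sub>R J p (hderiv k F p (replicate k v))) sums J p (F (p + v))"
  proof (rule real_analytic_taylor_sums[OF F])
    show "bounded_linear (J p)" using linJ linear_conv_bounded_linear by blast
    fix k :: nat
    consider "k = 0" | "k = 1" | "k \<ge> 2" by linarith
    \<comment> \<open>The three summands of the constant serve \<open>k = 0\<close>,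
      \<open>k = 1\<close> and \<open>k \<ge> 2\<close> in turn; the 6 compensates one factor
      1/6.\<close>
    then show "?t k \<le> (?t 0 + 6 * ?t 1 + 1 / g) * (1 / 6) ^ k"
    proof cases
      case 3
      have "?t k \<le> g ^ (k - 1) * norm v ^ k" using le[OF 3, of "replicate k v"] by simp
      also have "\<dots> \<le> g ^ (k - 1) * (1 / (6 * g)) ^ k"
        using v g by (intro mult_left_mono power_mono) simp_all
      also have "\<dots> = 1 / g * (1 / 6) ^ k"
        using 3 g by (cases k) (simp_all add: power_divide power_mult_distrib)
      also have "\<dots> \<le> (?t 0 + 6 * ?t 1 + 1 / g) * (1 / 6) ^ k"
        by (intro mult_right_mono) simp_all
      finally show ?thesis .
    qed (use g in \<open>simp_all add: field_simps\<close>)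
  qed simp_all
qed

text \<open>Averaging the two squared distances gives \<open>d\<^sup>2 - (norm e)\<^sup>2\<close>
  for the squared distance to \<open>m\<close>; completing the square then bounds its root.\<close>

lemma dist_midpoint_le:
  fixes x m e :: "'a::real_inner"
  assumes d: "d > 0" "dist x (m + e) = d" "dist x (m - e) = d"
  shows "dist x m \<le> d - (norm e)\<^sup>2 / (2 * d)" and "norm e \<le> d"
proof -
  have "(norm (x - m - e))\<^sup>2 = d\<^sup>2" "(norm (x - m + e))\<^sup>2 = d\<^sup>2"
    using d by (simp_all add: dist_norm algebra_simps)
  then have eq: "(norm (x - m))\<^sup>2 = d\<^sup>2 - (norm e)\<^sup>2"
    unfolding power2_norm_eq_inner by (simp add: inner_diff inner_add inner_commute)
  then have "(norm e)\<^sup>2 \<le> d\<^sup>2" using zero_le_power2[of "norm (x - m)"] by linarith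
  then show "norm e \<le> d" using d(1) by (simp add: power2_le_iff_abs_le)
  have "(dist x m)\<^sup>2 \<le> d\<^sup>2 - (norm e)\<^sup>2 + ((norm e)\<^sup>2 / (2 * d))\<^sup>2"
    using eq by (simp add: dist_norm)
  also have "\<dots> = (d - (norm e)\<^sup>2 / (2 * d))\<^sup>2"
    using d(1) by (simp add: power2_diff)
  finally show "dist x m \<le> d - (norm e)\<^sup>2 / (2 * d)"
  proof (rule power2_le_imp_le)
    have "(norm e)\<^sup>2 / (2 * d) \<le> d\<^sup>2 / (2 * d)"
      using \<open>(norm e)\<^sup>2 \<le> d\<^sup>2\<close> d(1) by (intro divide_right_mono) simp_all
    also have "\<dots> \<le> d" using d(1) by (simp add: power2_eq_square)
    finally show "0 \<le> d - (norm e)\<^sup>2 / (2 * d)" by simp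
  qed
qed

lemma dist_medial_pt_ge:
  fixes F :: "'a::euclidean_space \<Rightarrow> 'b::euclidean_space"
  assumes F: "real_analytic F" and surj: "surj (frechet_derivative F (at p))" and p: "F p = 0"
    and gamma: "gamma F p \<le> ereal g" and g: "g > 0" and x: "x \<in> medial_pts {x. F x = 0}"
  shows "1 / (14 * g) \<le> dist x p"
proof (rule ccontr)
  assume "\<not> 1 / (14 * g) \<le> dist x p"
  then have xp: "dist x p < 1 / (14 * g)" by simp
  let ?M = "{x. F x = 0}"
  define L where "L = frechet_derivative F (at p)"
  define J where "J = mp_inverse L"
  define G where "G = (\<lambda>y. J (F y))"
  define d where "d = infdist x ?M"
  obtain a b where ab: "F a = 0" "F b = 0" "a \<noteq> b" "dist x a = d" "dist x b = d"
    using x by (auto simp: medial_pts_def d_def)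
  have d_le: "d \<le> dist x y" if "F y = 0" for y
    unfolding d_def using that by (intro infdist_le) simp
  have "d > 0" using ab by (metis dist_eq_0_iff order_le_less zero_le_dist)
  have "d < 1 / (14 * g)" using d_le[OF p] xp by linarith
  then have d: "14 * g * d < 1" using g by (simp add: field_simps)
  define m where "m = (1 / 2) *\<^sub>R (a + b)"
  define e where "e = (1 / 2) *\<^sub>R (a - b)"
  have me: "m + e = a" "m - e = b"
    by (simp_all add: m_def e_def algebra_simps flip: scaleR_add_left)
  have "e \<noteq> 0" using ab(3) by (simp add: e_def)
  have mid: "dist x m \<le> d - (norm e)\<^sup>2 / (2 * d)" and e_le: "norm e \<le> d"
    using dist_midpoint_le[of d x m e] \<open>d > 0\<close> ab(4,5) me by simp_all
  \<comment> \<open>Since \<open>p\<close> is a zero, \<open>d\<close> is below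
    \<open>1 / (14 * g)\<close> too, and two such distances add up to at most
    \<open>1 / (7 * g)\<close>.\<close>
  have near: "norm (y - p) \<le> 1 / (7 * g)" if "dist x y \<le> d" for y
  proof -
    have "norm (y - p) \<le> dist x y + dist x p" by (metis dist_commute dist_norm dist_triangle2)
    also have "\<dots> \<le> 1 / (7 * g)" using that d_le[OF p] xp by simp
    finally show ?thesis .
  qed
  have "(norm e)\<^sup>2 / (2 * d) \<ge> 0" using \<open>d > 0\<close> by simp
  then have near_m: "norm (m - p) \<le> 1 / (7 * g)" using mid by (intro near) linarith
  have "1 / (7 * g) \<le> 1 / (6 * g)" using g by (simp add: field_simps)
  note near6 = order_trans[OF _ this]

  interpret bounded_taylor G "\<lambda>k vs. (1 / fact k) *\<^sub>R J (hderiv k F p vs)" p g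
    unfolding G_def J_def L_def by (rule bounded_taylor_newton[OF F surj gamma g])
  have linL: "linear L"
    unfolding L_def using F by (intro linear_derivative_smooth) (simp add: real_analytic_def)
  have surjL: "surj L" using surj by (simp add: L_def)
  have linJ: "linear J" unfolding J_def by (rule linear_mp_inverse[OF linL surjL])
  have LJ: "L (J y) = y" for y unfolding J_def by (rule mp_inverse_props(1)[OF linL surjL])
  \<comment> \<open>\<open>L\<close> undoes \<open>J\<close>, so \<open>J\<close> is injective and
    \<open>G\<close> has the same zeros as \<open>F\<close>.\<close>
  have J0: "J y = 0 \<longleftrightarrow> y = 0" for y using LJ[of y] linear_0[OF linJ] linear_0[OF linL] by metis

  \<comment> \<open>As \<open>G\<close> vanishes at \<open>a\<close> and \<open>b\<close>, this
    second difference is just \<open>- 2 *\<^sub>R G m\<close>.\<close>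
  have "norm (G (p + (m - p + e)) + G (p + (m - p - e)) - 2 *\<^sub>R G (p + (m - p))) \<le> 4 * g * (norm e)\<^sup>2"
    using near[of a] near[of b] near_m ab(4,5) me
    by (intro second_diff_le near6) (simp_all add: algebra_simps)
  moreover have "p + (m - p + e) = a" "p + (m - p - e) = b" using me by (simp_all add: algebra_simps)
  moreover have "G a = 0" "G b = 0" using ab J0 by (simp_all add: G_def)
  ultimately have Gm: "norm (G m) \<le> 2 * g * (norm e)\<^sup>2" by simp

  \<comment> \<open>Chosen so that the bound \<open>2 * g * (norm e)\<^sup>2\<close> on
    \<open>G m\<close> equals \<open>(1 - 4 / 9) * \<rho>\<close>.\<close>
  define \<rho> where "\<rho> = 18 / 5 * g * (norm e)\<^sup>2"
  have "(norm e)\<^sup>2 \<le> d\<^sup>2" using e_le by (simp add: power_mono)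
  have "\<exists>c. norm (c - m) \<le> \<rho> \<and> G c = 0"
  proof (rule exists_zero_near)
    show "subspace (range J)" using linear_subspace_image[OF linJ subspace_UNIV] .
    show "G y \<in> range J" for y by (simp add: G_def)
    show "J (L v) = v" if "v \<in> range J" for v using that LJ by auto
    show "norm (G (p + v) - G (p + w) - J (L (v - w))) \<le> 4 / 9 * norm (v - w)"
      if "norm v \<le> 1 / (6 * g)" "norm w \<le> 1 / (6 * g)" for v w
      using diff_le[OF that] by (simp add: L_def)
    \<comment> \<open>With \<open>norm e \<le> d\<close>, this gives \<open>g * \<rho>\<close> at
      most 18/5 divided by 196, below 1/42; and 1/7 + 1/42 = 1/6 is the radius allowed.\<close>
    have "14 * 14 * (g * g * d\<^sup>2) \<le> 1"
      using mult_mono[of "14 * g * d" 1 "14 * g * d" 1] d g \<open>d > 0\<close> by (simp add: power2_eq_square mult_ac)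
    moreover have "g * g * (norm e)\<^sup>2 \<le> g * g * d\<^sup>2"
      using \<open>(norm e)\<^sup>2 \<le> d\<^sup>2\<close> g by (intro mult_left_mono) simp_all
    ultimately have "g * \<rho> \<le> 1 / 42" by (simp add: \<rho>_def)
    then have "\<rho> \<le> 1 / (42 * g)" using g by (simp add: field_simps)
    then have "norm (m - p) + \<rho> \<le> 1 / (7 * g) + 1 / (42 * g)" using near_m by linarith
    then show "norm (m - p) + \<rho> \<le> 1 / (6 * g)" using g by (simp add: field_simps)
    show "norm (G m) \<le> (1 - 4 / 9) * \<rho>" using Gm by (simp add: \<rho>_def)
    show "0 \<le> \<rho>" using g by (simp add: \<rho>_def)
  qed simp_all
  then obtain c where c: "norm (c - m) \<le> \<rho>" "G c = 0" by blast
  then have "F c = 0" using J0 by (simp add: G_def)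
  have "dist x c \<le> dist x m + norm (c - m)" by (metis dist_commute dist_norm dist_triangle)
  also have "\<dots> \<le> d - (norm e)\<^sup>2 / (2 * d) + \<rho>" using mid c by simp
  also have "\<dots> < d"
  \<comment> \<open>The claim amounts to \<open>36 / 5 * g * d < 1\<close>, which is weaker than
    \<open>14 * g * d < 1\<close>.\<close>
  proof -
    have "g * d > 0" using g \<open>d > 0\<close> by simp
    then have "36 / 5 * g * d < 1" using d by linarith
    then have "36 / 5 * g * d * (norm e)\<^sup>2 < 1 * (norm e)\<^sup>2"
      using \<open>e \<noteq> 0\<close> by (intro mult_strict_right_mono) simp_all
    then have "\<rho> < (norm e)\<^sup>2 / (2 * d)" using \<open>d > 0\<close> by (simp add: \<rho>_def field_simps)
    then show ?thesis by simp
  qed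
  finally show False using d_le[OF \<open>F c = 0\<close>] by simp
qed

text \<open>When \<open>gamma F p = 0\<close> the quotient is infinite in \<open>ereal\<close>, so
  the inequality then says that the medial axis is empty.\<close>

theorem theorem3p3:
  fixes F :: "'a::euclidean_space \<Rightarrow> real ^ 'm"
    and p :: 'a
  assumes "real_analytic F"
    and "CARD('m) \<le> DIM('a)"
    and "F p = 0"
    and "gamma F p < \<infinity>"
  shows "1 / (14 * gamma F p) \<le> reach {x. F x = 0} p"
proof (cases "medial_axis {x. F x = 0} = {}")
  \<comment> \<open>Treated apart because \<open>infdist\<close> to the empty set is 0, whereas
    \<open>edist_set\<close> is infinite there.\<close>
  case True
  then show ?thesis by (simp add: reach_def edist_set_def)
next
  case False
  let ?M = "{x. F x = 0}"
  have surj: "surj (frechet_derivative F (at p))"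
    using assms(4) by (auto simp: gamma_def split: if_splits)
  \<comment> \<open>The complement of an open ball is closed, so the bound for medial points
    survives the closure.\<close>
  have ge: "1 / (14 * g) \<le> infdist p (medial_axis ?M)" if "g > 0" "gamma F p \<le> ereal g" for g
  proof -
    have "medial_pts ?M \<subseteq> - ball p (1 / (14 * g))"
      using dist_medial_pt_ge[OF assms(1) surj assms(3) that(2,1)] by (fastforce simp: dist_commute)
    then have "medial_axis ?M \<subseteq> - ball p (1 / (14 * g))"
      unfolding medial_axis_def by (rule closure_minimal) (rule closed_Compl[OF open_ball])
    then show ?thesis
      using False by (auto simp: infdist_def intro!: cINF_greatest)
  qed
  \<comment> \<open>Otherwise \<open>ge\<close> would hold for every positive \<open>g\<close>; the
    value \<open>1 / (14 * (D + 1))\<close> turns it into \<open>D + 1 \<le> D\<close>.\<close>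
  have "\<not> gamma F p \<le> 0"
  proof
    assume *: "gamma F p \<le> 0"
    define D where "D = infdist p (medial_axis ?M)"
    have "D \<ge> 0" by (simp add: D_def infdist_nonneg)
    have "1 / (14 * (1 / (14 * (D + 1)))) \<le> D"
      unfolding D_def
    proof (rule ge)
      show pos: "0 < 1 / (14 * (infdist p (medial_axis ?M) + 1))"
        using \<open>D \<ge> 0\<close> by (simp add: D_def)
      show "gamma F p \<le> ereal (1 / (14 * (infdist p (medial_axis ?M) + 1)))"
        using * pos by (meson ereal_less_eq(5) less_imp_le order_trans)
    qed
    then show False by simp
  qed
  then obtain g where g: "gamma F p = ereal g" "g > 0"
    using assms(4) by (cases "gamma F p") auto
  have "1 / (14 * gamma F p) = ereal (1 / (14 * g))" using g by (simp add: one_ereal_def)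
  then show ?thesis using ge[OF g(2)] g(1) False by (simp add: reach_def edist_set_def)
qed

end
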